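(* Let $q$ be a prime power and $n\ge 2$ an integer. Let $\mathcal{F}^{n-1}$ be the $(q^{n-1}-1)$-factorization of $\frac{q^{n-1}-1}{q-1}K_{q^n}$ whose factors are the $F_\Pi$, one for each $(n-2)$-dimensional subspace $\Pi$ of the hyperplane at infinity of $\mathrm{AG}(n,q)$. Then $\mathcal{F}^{n-1}$ is indecomposable.
   Context: The complete multigraph $\lambda K_v$ has $v$ vertices and exactly $\lambda$ edges joining each pair of distinct vertices. An $m$-factor of $\lambda K_v$ is a set of pairwise vertex-disjoint $m$-regular subgraphs which induce a partition of the vertices (i.e. a spanning $m$-regular subgraph). An $m$-factorization of $\lambda K_v$ is a collection of pairwise edge-disjoint $m$-factors inducing a partition of the edges; equivalently, regarding factors as graphs on the $v$ vertices, a family (multiset) of $m$-regular simple spanning graphs (all factors here are simple graphs) such that each pair of distinct vertices is joined in exactly $\lambda$ of them. It is decomposable if there exist positive integers $\mu_1,\mu_2$ with $\mu_1+\mu_2=\lambda$ such that it is the union of an $m$-factorization of $\mu_1K_v$ and an $m$-factorization of $\mu_2K_v$; otherwise it is indecomposable. $\mathrm{AG}(n,q)=\mathrm{PG}(n,q)\setminus\mathcal{H}_\infty$ for a fixed hyperplane $\mathcal{H}_\infty$ (the hyperplane at infinity, isomorphic to $\mathrm{PG}(n-1,q)$). The vertices of the multigraph are identified with the $q^n$ points of $\mathrm{AG}(n,q)$. For an $(n-2)$-dimensional projective subspace $\Pi$ of $\mathcal{H}_\infty$, $F_\Pi$ is the vertex-disjoint union of the complete graphs on the point sets of the $q$ parallel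 affine hyperplanes whose projective closures meet $\mathcal{H}_\infty$ in $\Pi$. *)

theory Defs
  imports "HOL-Analysis.Cartesian_Space" "HOL-Library.Multiset"
begin

text \<open>
  A simple graph on a vertex set \<open>V\<close> is given by its set of edges, each edge being a
  two-element subset of \<open>V\<close>. All graphs here are spanning, so \<open>V\<close> is kept separate.
\<close>

definition complete_edges :: "'v set \<Rightarrow> 'v set set" where
  "complete_edges V = {e. e \<subseteq> V \<and> card e = 2}"

definition graph_factor :: "'v set \<Rightarrow> nat \<Rightarrow> 'v set set \<Rightarrow> bool" where
  "graph_factor V m E \<longleftrightarrow>
     E \<subseteq> complete_edges V \<and> (\<forall>v\<in>V. card {e \<in> E. v \<in> e} = m)"

text \<open>
  \<open>graph_factorization V m l \<F>\<close>: \<open>\<F>\<close> is an \<open>m\<close>-factorization of the complete multigraph with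
  \<open>l\<close> edges between any two distinct vertices of \<open>V\<close>. The \<open>l\<close> parallel edges on a pair are not
  named individually, so edge-disjointness and covering together say that every pair is an
  edge of exactly \<open>l\<close> factors, counted with multiplicity.
\<close>

definition graph_factorization :: "'v set \<Rightarrow> nat \<Rightarrow> nat \<Rightarrow> 'v set set multiset \<Rightarrow> bool" where
  "graph_factorization V m l \<F> \<longleftrightarrow>
     (\<forall>E \<in># \<F>. graph_factor V m E) \<and>
     (\<forall>e \<in> complete_edges V. size (filter_mset (\<lambda>E. e \<in> E) \<F>) = l)"

definition decomposable :: "'v set \<Rightarrow> nat \<Rightarrow> nat \<Rightarrow> 'v set set multiset \<Rightarrow> bool" where
  "decomposable V m l \<F> \<longleftrightarrow>
     (\<exists>l1 l2 \<F>1 \<F>2. 0 < l1 \<and> 0 < l2 \<and> l1 + l2 = l \<and> \<F> = \<F>1 + \<F>2 \<and>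
        graph_factorization V m l1 \<F>1 \<and> graph_factorization V m l2 \<F>2)"

text \<open>
  The projective space \<open>PG(n, q)\<close> is the lattice of linear subspaces of \<open>'k ^ 'm\<close>, where
  \<open>CARD('k) = q\<close> and \<open>CARD('m) = n + 1\<close>: a projective subspace of dimension \<open>d\<close> is a linear
  subspace of dimension \<open>d + 1\<close>, and incidence is inclusion. In particular the points
  are the one-dimensional linear subspaces.
\<close>

definition proj_subspace :: "nat \<Rightarrow> ('k::field ^ 'm::finite) set \<Rightarrow> bool" where
  "proj_subspace d S \<longleftrightarrow> vec.subspace S \<and> vec.dim S = d + 1"

definition proj_hyperplane :: "('k::field ^ 'm::finite) set \<Rightarrow> bool" where
  "proj_hyperplane S \<longleftrightarrow> vec.subspace S \<and> vec.dim S + 1 = CARD('m)"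

text \<open>
  In the following, \<open>H\<close> is the hyperplane at infinity. The set \<open>affine_part H S\<close> consists of
  the points of \<open>S\<close> not on \<open>H\<close>; if \<open>S\<close> is not contained in \<open>H\<close>, it is the affine subspace with
  projective closure \<open>S\<close>.
\<close>

definition affine_part ::
    "('k::field ^ 'm::finite) set \<Rightarrow> ('k ^ 'm) set \<Rightarrow> ('k ^ 'm) set set" where
  "affine_part H S = {P. proj_subspace 0 P \<and> P \<subseteq> S \<and> \<not> P \<subseteq> H}"

definition AG_points :: "('k::field ^ 'm::finite) set \<Rightarrow> ('k ^ 'm) set set" where
  "AG_points H = affine_part H UNIV"

definition parallel_hyperplanes ::
    "('k::field ^ 'm::finite) set \<Rightarrow> ('k ^ 'm) set \<Rightarrow> ('k ^ 'm) set set set" where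
  "parallel_hyperplanes H W = {affine_part H S | S. proj_hyperplane S \<and> S \<inter> H = W}"

definition parallel_factor ::
    "('k::field ^ 'm::finite) set \<Rightarrow> ('k ^ 'm) set \<Rightarrow> ('k ^ 'm) set set set" where
  "parallel_factor H W = (\<Union>A \<in> parallel_hyperplanes H W. complete_edges A)"

definition AG_factorization ::
    "nat \<Rightarrow> ('k::{field,finite} ^ 'm::finite) set \<Rightarrow> ('k ^ 'm) set set set multiset" where
  "AG_factorization n H =
     image_mset (parallel_factor H) (mset_set {W. proj_subspace (n - 2) W \<and> W \<subseteq> H})"

end

theory Submission
  imports Defs
begin

text \<open>
  Indecomposability is a divisibility argument. Let \<open>m = q ^ (n - 1) - 1\<close> and
  \<open>l = m div (q - 1)\<close>. Suppose that a subfamily of \<open>r\<close> factors is an \<open>m\<close>-factorization in which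
  each pair of vertices is covered \<open>l1\<close> times. Counting the edges at one vertex in two ways gives
  \<open>r * m = l1 * (q ^ n - 1)\<close>, and dividing by \<open>q - 1\<close> gives \<open>r * l = l1 * (q * l + 1)\<close>. Since
  \<open>l\<close> is coprime to \<open>q * l + 1\<close>, it divides \<open>l1\<close>, so \<open>0 < l1 < l\<close> is impossible
  (\<open>indecomposable_if_coprime\<close>).

  The remaining work is to see that the parallel classes do form such a factorization. Fix a
  vector \<open>a\<close> outside the hyperplane at infinity \<open>H\<close>. Every affine point is spanned by \<open>a + h\<close>
  for exactly one \<open>h \<in> H\<close> (\<open>bij_betw_affine_pt\<close>), which identifies the affine space with the
  vector space \<open>H\<close>. Under this identification the factor of a hyperplane \<open>W\<close> of \<open>H\<close> joins \<open>h\<close>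
  and \<open>h'\<close> if and only if they are distinct and congruent modulo \<open>W\<close>
  (\<open>parallel_factor_edge_iff\<close>). Degrees are therefore \<open>card W - 1\<close>, and the multiplicity of a
  pair is the number of hyperplanes of \<open>H\<close> through a given nonzero vector
  (\<open>card_hyperplanes_through\<close>).
\<close>

section \<open>Factorizations of complete multigraphs\<close>

lemma card_incident_edges:
  assumes "finite V" and "v \<in> V"
  shows "card {e \<in> complete_edges V. v \<in> e} = card V - 1"
proof -
  have "{e \<in> complete_edges V. v \<in> e} = (\<lambda>w. {v, w}) ` (V - {v})"
    using assms(2) by (auto simp: complete_edges_def card_2_iff insert_commute)
  moreover have "inj_on (\<lambda>w. {v, w}) (V - {v})"
    by (auto simp: inj_on_def doubleton_eq_iff)
  ultimately show ?thesis
    using assms by (simp add: card_image)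
qed

text \<open>
  Both sides count the pairs of a factor and an edge of it at \<open>v\<close>. Factors may be repeated, so
  the count is by induction on the multiset. The set \<open>K\<close> stands for all possible edges at \<open>v\<close>.
\<close>

lemma sum_degrees_eq_sum_multiplicities:
  assumes "finite K"
    and "\<And>E. E \<in># \<F> \<Longrightarrow> {e \<in> E. v \<in> e} \<subseteq> K"
    and "\<And>e. e \<in> K \<Longrightarrow> v \<in> e"
  shows "(\<Sum>E\<in>#\<F>. card {e \<in> E. v \<in> e}) = (\<Sum>e\<in>K. size (filter_mset (\<lambda>E. e \<in> E) \<F>))"
  using assms(2)
proof (induction \<F>)
  case empty
  then show ?case by simp
next
  case (add E \<F>)
  have "{e \<in> E. v \<in> e} = {e \<in> K. e \<in> E}"
    using add.prems assms(3) by auto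
  then have "card {e \<in> E. v \<in> e} = (\<Sum>e\<in>K. if e \<in> E then 1 else 0)"
    using assms(1) by (simp add: sum.inter_filter [symmetric])
  then show ?case
    using add by (simp add: sum.distrib [symmetric] if_distrib cong: if_cong sum.cong)
      (auto intro!: sum.cong)
qed

lemma graph_factorization_size:
  assumes "graph_factorization V m l \<F>" and "finite V" and "v \<in> V"
  shows "size \<F> * m = l * (card V - 1)"
proof -
  let ?K = "{e \<in> complete_edges V. v \<in> e}"
  have fin: "finite ?K"
    using assms(2) by (auto simp: complete_edges_def)
  have deg: "card {e \<in> E. v \<in> e} = m" if "E \<in># \<F>" for E
    using assms that by (auto simp: graph_factorization_def graph_factor_def)
  have "size \<F> * m = (\<Sum>E\<in>#\<F>. card {e \<in> E. v \<in> e})"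
    using deg by (simp cong: image_mset_cong)
  also have "\<dots> = (\<Sum>e\<in>?K. size (filter_mset (\<lambda>E. e \<in> E) \<F>))"
    using assms(1) fin
    by (intro sum_degrees_eq_sum_multiplicities)
      (auto simp: graph_factorization_def graph_factor_def)
  also have "\<dots> = l * (card V - 1)"
    using assms by (simp add: graph_factorization_def card_incident_edges)
  finally show ?thesis .
qed

text \<open>
  The size equation of \<open>graph_factorization_size\<close> for one part of a decomposition makes \<open>l\<close> divide
  \<open>l1 * t\<close>, hence \<open>l1\<close>, although \<open>0 < l1 < l\<close>.
\<close>

lemma indecomposable_if_coprime:
  assumes "finite V" and "V \<noteq> {}" and "0 < d"
    and "card V - 1 = t * d" and "coprime l t"
  shows "\<not> decomposable V (l * d) l \<F>"
proof
  assume "decomposable V (l * d) l \<F>"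
  then obtain l1 l2 \<F>1 where l: "0 < l1" "0 < l2" "l1 + l2 = l"
    and F1: "graph_factorization V (l * d) l1 \<F>1"
    by (auto simp: decomposable_def)
  obtain v where "v \<in> V"
    using assms(2) by blast
  then have "size \<F>1 * (l * d) = l1 * (t * d)"
    using graph_factorization_size [OF F1] assms by metis
  then have "l1 * t = l * size \<F>1"
    using assms(3) by (simp add: mult.commute)
  then have "l dvd l1"
    using assms(5) by (metis coprime_dvd_mult_left_iff dvd_triv_left)
  then show False
    using l by (auto dest: dvd_imp_le)
qed

section \<open>Counting in vector spaces over a finite field\<close>

lemma card_field_ge_2: "2 \<le> CARD('k::{field,finite})"
proof -
  have "card {0, 1 :: 'k} \<le> CARD('k)"
    by (rule card_mono) auto
  then show ?thesis by simp
qed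

lemma card_span_independent:
  fixes B :: "('k::{field,finite} ^ 'm::finite) set"
  assumes "vec.independent B"
  shows "card (vec.span B) = CARD('k) ^ card B"
proof -
  have fin: "finite B" by simp
  let ?f = "\<lambda>g. \<Sum>b\<in>B. g b *s b"
  have inj: "inj_on ?f (B \<rightarrow>\<^sub>E UNIV)"
  proof (rule inj_onI)
    fix g h assume gh: "g \<in> B \<rightarrow>\<^sub>E (UNIV :: 'k set)" "h \<in> B \<rightarrow>\<^sub>E (UNIV :: 'k set)" "?f g = ?f h"
    then have "(\<Sum>b\<in>B. (g b - h b) *s b) = 0"
      by (simp add: vec.scale_left_diff_distrib sum_subtractf)
    then have "g b - h b = 0" if "b \<in> B" for b
      using vec.independentD [OF assms fin subset_refl, of "\<lambda>b. g b - h b"] that by blast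
    then show "g = h"
      by (intro PiE_ext [OF gh(1,2)]) auto
  qed
  have "?f ` (B \<rightarrow>\<^sub>E UNIV) = vec.span B"
  proof
    show "?f ` (B \<rightarrow>\<^sub>E UNIV) \<subseteq> vec.span B"
      by (intro image_subsetI vec.span_sum vec.span_scale vec.span_base)
  next
    show "vec.span B \<subseteq> ?f ` (B \<rightarrow>\<^sub>E UNIV)"
    proof
      fix x assume "x \<in> vec.span B"
      then obtain u where "x = ?f u"
        using vec.span_finite [OF fin] by auto
      also have "?f u = ?f (restrict u B)"
        by (rule sum.cong) auto
      finally show "x \<in> ?f ` (B \<rightarrow>\<^sub>E UNIV)"
        by (intro image_eqI [where x = "restrict u B"]) auto
    qed
  qed
  with card_image [OF inj] have "card (vec.span B) = card (B \<rightarrow>\<^sub>E (UNIV :: 'k set))"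
    by simp
  then show ?thesis
    by (simp add: card_PiE)
qed

lemma card_subspace:
  fixes S :: "('k::{field,finite} ^ 'm::finite) set"
  assumes "vec.subspace S"
  shows "card S = CARD('k) ^ vec.dim S"
proof -
  obtain B where B: "B \<subseteq> S" "vec.independent B" "S \<subseteq> vec.span B" "card B = vec.dim S"
    using vec.basis_exists by blast
  then have "S = vec.span B"
    using assms vec.span_minimal by blast
  with B card_span_independent show ?thesis by metis
qed

lemma dim_span_insert_subspace:
  assumes "vec.subspace W" and "d \<notin> W"
  shows "vec.dim (vec.span (insert d W)) = vec.dim W + 1"
  using assms by (simp add: vec.dim_insert vec.span_eq_iff [THEN iffD2])

lemma span_insert_hyperplane:
  assumes "vec.subspace U" "vec.subspace W" "W \<subseteq> U" "d \<in> U" "d \<notin> W"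
    and "vec.dim U \<le> vec.dim W + 1"
  shows "vec.span (insert d W) = U"
proof (rule vec.subspace_dim_equal)
  show "vec.span (insert d W) \<subseteq> U"
    using assms by (intro vec.span_minimal) auto
  show "vec.dim U \<le> vec.dim (vec.span (insert d W))"
    using dim_span_insert_subspace [OF assms(2,5)] assms(6) by simp
qed (use assms in auto)

text \<open>
  Hyperplanes relative to an arbitrary subspace, as opposed to those of the whole space: the
  parallel classes are indexed by the hyperplanes of the hyperplane at infinity.
\<close>

definition hyperplanes_of :: "('k::field ^ 'm::finite) set \<Rightarrow> ('k ^ 'm) set set" where
  "hyperplanes_of U = {W. vec.subspace W \<and> W \<subseteq> U \<and> vec.dim W + 1 = vec.dim U}"

text \<open>
  The line spanned by \<open>d\<close> is a complement of \<open>W\<close> in \<open>U\<close>, so \<open>c\<close> is the coordinate of \<open>x\<close> along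
  \<open>d\<close> in this direct sum.
\<close>

lemma hyperplane_unique_translate:
  assumes U: "vec.subspace U" and W: "W \<in> hyperplanes_of U" and d: "d \<in> U" "d \<notin> W"
    and x: "x \<in> U"
  shows "\<exists>!c. x - c *s d \<in> W"
proof -
  have sub: "vec.subspace W" "W \<subseteq> U" "vec.dim U \<le> vec.dim W + 1"
    using W by (auto simp: hyperplanes_of_def)
  have "x \<in> vec.span (insert d W)"
    using span_insert_hyperplane [OF U sub(1,2) d sub(3)] x by simp
  then obtain c where c: "x - c *s d \<in> W"
    using sub(1) by (auto simp: vec.span_insert vec.span_eq_iff [THEN iffD2])
  moreover have "c' = c" if "x - c' *s d \<in> W" for c'
  proof (rule ccontr)
    assume "c' \<noteq> c"
    have "(x - c *s d) - (x - c' *s d) \<in> W"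
      using c that sub(1) vec.subspace_diff by blast
    then have "(c' - c) *s d \<in> W"
      by (simp add: vec.scale_left_diff_distrib)
    then have "inverse (c' - c) *s ((c' - c) *s d) \<in> W"
      using sub(1) vec.subspace_scale by blast
    then show False
      using \<open>c' \<noteq> c\<close> d(2) by simp
  qed
  ultimately show ?thesis by blast
qed

text \<open>
  Extend \<open>d\<close> to a basis of \<open>U\<close>, with further basis vectors \<open>A\<close>. A hyperplane \<open>W\<close> that avoids \<open>d\<close>
  is the kernel of a unique linear functional with value \<open>1\<close> at \<open>d\<close>, and this functional is
  determined by arbitrary values \<open>g\<close> on \<open>A\<close>. Without mentioning functionals: \<open>W\<close> contains exactly
  one vector \<open>b - g b *s d\<close> for each \<open>b \<in> A\<close>, and these vectors span it. Hence there are as many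
  such hyperplanes as functions from \<open>A\<close> to the field.
\<close>

lemma card_hyperplanes_avoiding:
  fixes U :: "('k::{field,finite} ^ 'm::finite) set"
  assumes U: "vec.subspace U" and d: "d \<in> U" "d \<noteq> 0"
  shows "card {W \<in> hyperplanes_of U. d \<notin> W} = CARD('k) ^ (vec.dim U - 1)"
proof -
  have "vec.independent {d}"
    using d(2) by (simp add: vec.independent_insert)
  then obtain B where B: "{d} \<subseteq> B" "B \<subseteq> U" "vec.independent B" "U \<subseteq> vec.span B"
    using vec.maximal_independent_subset_extend [of "{d}" U] d(1) by auto
  have spanB: "vec.span B = U"
    using B U vec.span_minimal by blast
  have dimU: "vec.dim U = card B"
    using B(3) spanB vec.dim_span_eq_card_independent by metis
  define A where "A = B - {d}"
  have Bd: "B = insert d A" "d \<notin> A"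
    using B(1) by (auto simp: A_def)
  have cardA: "card A + 1 = vec.dim U"
    using Bd dimU by simp
  define K where "K g = vec.span ((\<lambda>b. b - g b *s d) ` A)" for g :: "'k ^ 'm \<Rightarrow> 'k"
  have sub_K: "vec.subspace (K g)" for g
    by (simp add: K_def)
  have K_U: "K g \<subseteq> U" for g
    unfolding K_def using U B(2) d(1)
    by (intro vec.span_minimal) (auto simp: A_def intro!: vec.subspace_diff vec.subspace_scale)
  (* K g and d together span U, so K g has codimension at most 1. As it is spanned by card A
     vectors, it is a hyperplane, and d lies outside it. *)
  have K_d: "vec.span (insert d (K g)) = U" for g
  proof
    show "vec.span (insert d (K g)) \<subseteq> U"
      using K_U d(1) U by (intro vec.span_minimal) auto
    have "b \<in> vec.span (insert d (K g))" if "b \<in> A" for b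
    proof -
      have "b - g b *s d \<in> K g"
        unfolding K_def using that by (intro vec.span_base) auto
      then have "(b - g b *s d) + g b *s d \<in> vec.span (insert d (K g))"
        by (intro vec.span_add vec.span_scale) (auto intro: vec.span_base)
      then show ?thesis by simp
    qed
    then have "B \<subseteq> vec.span (insert d (K g))"
      using Bd by (auto intro: vec.span_base)
    then show "U \<subseteq> vec.span (insert d (K g))"
      using spanB vec.span_minimal by (metis vec.subspace_span)
  qed
  have "vec.dim (K g) \<le> card A" for g
  proof -
    have "vec.dim (K g) \<le> card ((\<lambda>b. b - g b *s d) ` A)"
      by (rule vec.dim_le_card) (simp_all add: K_def)
    also have "\<dots> \<le> card A"
      by (rule card_image_le) simp
    finally show ?thesis .
  qed
  moreover have "d \<notin> K g \<and> card A \<le> vec.dim (K g)" for g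
  proof -
    have *: "vec.dim U = (if d \<in> K g then vec.dim (K g) else vec.dim (K g) + 1)"
      using K_d [of g] vec.dim_insert [of d "K g"] sub_K [of g]
      by (metis vec.dim_span vec.span_eq_iff)
    with calculation [of g] cardA show ?thesis
      by (auto split: if_splits)
  qed
  ultimately have "d \<notin> K g \<and> vec.dim (K g) = card A" for g
    by (simp add: le_antisym)
  then have K_hyp: "K g \<in> {W \<in> hyperplanes_of U. d \<notin> W}" for g
    using sub_K K_U cardA by (simp add: hyperplanes_of_def)
  have "bij_betw K (A \<rightarrow>\<^sub>E UNIV) {W \<in> hyperplanes_of U. d \<notin> W}"
  proof (rule bij_betwI')
    fix g h assume gh: "g \<in> A \<rightarrow>\<^sub>E (UNIV :: 'k set)" "h \<in> A \<rightarrow>\<^sub>E (UNIV :: 'k set)"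
    show "K g = K h \<longleftrightarrow> g = h"
    proof
      assume eq: "K g = K h"
      have "g b = h b" if "b \<in> A" for b
      proof -
        have "b - g b *s d \<in> K g" "b - h b *s d \<in> K h"
          unfolding K_def using that by (auto intro: vec.span_base)
        moreover have "b \<in> U"
          using that B(2) by (auto simp: A_def)
        ultimately show ?thesis
          using hyperplane_unique_translate [OF U _ d(1), of "K g" b] K_hyp eq by auto
      qed
      then show "g = h"
        by (intro PiE_ext [OF gh]) auto
    qed simp
  next
    fix W assume W: "W \<in> {W \<in> hyperplanes_of U. d \<notin> W}"
    have "\<exists>c. b - c *s d \<in> W" if "b \<in> A" for b
      using hyperplane_unique_translate [OF U _ d(1), of W b] W that B(2)
      by (auto simp: A_def)
    then obtain g where g: "\<And>b. b \<in> A \<Longrightarrow> b - g b *s d \<in> W"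
      by metis
    have "K (restrict g A) \<subseteq> W"
      unfolding K_def using W g
      by (intro vec.span_minimal) (auto simp: hyperplanes_of_def)
    moreover have "vec.dim W \<le> vec.dim (K (restrict g A))"
      using W K_hyp [of "restrict g A"] by (auto simp: hyperplanes_of_def)
    ultimately have "K (restrict g A) = W"
      using W sub_K by (intro vec.subspace_dim_equal) (auto simp: hyperplanes_of_def)
    then show "\<exists>g\<in>A \<rightarrow>\<^sub>E UNIV. W = K g"
      by (intro bexI [of _ "restrict g A"]) auto
  qed (use K_hyp in auto)
  then have "card {W \<in> hyperplanes_of U. d \<notin> W} = card (A \<rightarrow>\<^sub>E (UNIV :: 'k set))"
    by (rule bij_betw_same_card [symmetric])
  moreover have "vec.dim U - 1 = card A"
    using cardA by simp
  ultimately show ?thesis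
    by (simp add: card_PiE)
qed

text \<open>
  Count the pairs of a hyperplane and a vector of \<open>U\<close> outside it: with \<open>r = vec.dim U - 1\<close>, each
  hyperplane misses \<open>q ^ (r + 1) - q ^ r\<close> vectors, and each of the \<open>q ^ (r + 1) - 1\<close> nonzero
  vectors is avoided by \<open>q ^ r\<close> hyperplanes. The equation is stated as a product because natural
  number division would lose that it is exact.
\<close>

lemma card_hyperplanes:
  fixes U :: "('k::{field,finite} ^ 'm::finite) set"
  assumes U: "vec.subspace U" and pos: "0 < vec.dim U"
  shows "card (hyperplanes_of U) * (CARD('k) - 1) = CARD('k) ^ vec.dim U - 1"
proof -
  define q where "q = CARD('k)"
  obtain r where r: "vec.dim U = Suc r"
    using pos by (cases "vec.dim U") auto
  have q: "2 \<le> q"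
    using card_field_ge_2 by (simp add: q_def)
  have avoid: "card {d \<in> U - {0}. d \<notin> W} = (q - 1) * q ^ r" if "W \<in> hyperplanes_of U" for W
  proof -
    have W: "vec.subspace W" "W \<subseteq> U" "vec.dim W = r"
      using that r by (auto simp: hyperplanes_of_def)
    have "{d \<in> U - {0}. d \<notin> W} = U - W"
      using W(1) vec.subspace_0 by auto
    then show ?thesis
      using card_subspace [OF U] card_subspace [OF W(1)] W r
      by (simp add: card_Diff_subset q_def diff_mult_distrib)
  qed
  have "(\<Sum>W\<in>hyperplanes_of U. card {d \<in> U - {0}. d \<notin> W})
      = (\<Sum>d\<in>U - {0}. card {W \<in> hyperplanes_of U. d \<notin> W})"
    by (rule sum_multicount_gen) auto
  then have "card (hyperplanes_of U) * ((q - 1) * q ^ r) = card (U - {0}) * q ^ r"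
    using avoid card_hyperplanes_avoiding [OF U] r by (simp add: q_def)
  moreover have "card (U - {0}) = q ^ vec.dim U - 1"
    using card_subspace [OF U] vec.subspace_0 [OF U] by (simp add: q_def)
  ultimately show ?thesis
    using q by (simp add: q_def)
qed

lemma card_hyperplanes_through:
  fixes U :: "('k::{field,finite} ^ 'm::finite) set"
  assumes U: "vec.subspace U" and d: "d \<in> U" "d \<noteq> 0"
  shows "card {W \<in> hyperplanes_of U. d \<in> W} * (CARD('k) - 1) = CARD('k) ^ (vec.dim U - 1) - 1"
proof -
  have "vec.dim U \<noteq> 0"
    using d vec.dim_eq_0 [of U] by auto
  then obtain r where r: "vec.dim U = Suc r"
    by (cases "vec.dim U") auto
  have "card ({W \<in> hyperplanes_of U. d \<in> W} \<union> {W \<in> hyperplanes_of U. d \<notin> W})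
      = card {W \<in> hyperplanes_of U. d \<in> W} + card {W \<in> hyperplanes_of U. d \<notin> W}"
    by (rule card_Un_disjoint) auto
  moreover have "{W \<in> hyperplanes_of U. d \<in> W} \<union> {W \<in> hyperplanes_of U. d \<notin> W}
      = hyperplanes_of U"
    by auto
  ultimately have "card (hyperplanes_of U) * (CARD('k) - 1)
      = card {W \<in> hyperplanes_of U. d \<in> W} * (CARD('k) - 1) + CARD('k) ^ r * (CARD('k) - 1)"
    using card_hyperplanes_avoiding [OF assms] r by (simp add: add_mult_distrib)
  moreover have "CARD('k) ^ r * (CARD('k) - 1) = CARD('k) ^ Suc r - CARD('k) ^ r"
    by (simp add: diff_mult_distrib2 mult.commute)
  moreover have "CARD('k) ^ r \<le> CARD('k) ^ Suc r" "1 \<le> CARD('k) ^ r"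
    using card_field_ge_2 [where 'k = 'k] by auto
  ultimately show ?thesis
    using card_hyperplanes [OF U] r by (simp del: power_Suc)
qed

section \<open>Affine points and parallel classes\<close>

definition affine_pt :: "'k::field ^ 'm::finite \<Rightarrow> 'k ^ 'm \<Rightarrow> ('k ^ 'm) set" where
  "affine_pt a h = vec.span {a + h}"

lemma affine_pt_subset_iff:
  assumes "vec.subspace S"
  shows "affine_pt a h \<subseteq> S \<longleftrightarrow> a + h \<in> S"
  using assms vec.span_minimal [of "{a + h}" S] vec.span_base [of "a + h" "{a + h}"]
  by (auto simp: affine_pt_def)

lemma translate_notin:
  assumes "vec.subspace H" and "a \<notin> H" and "h \<in> H"
  shows "a + h \<notin> H"
  using assms vec.subspace_diff [of H "a + h" h] by auto

lemma scale_mem_iff: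
  assumes "vec.subspace S" and "x \<notin> S"
  shows "c *s x \<in> S \<longleftrightarrow> c = 0"
proof
  assume "c *s x \<in> S"
  then have "inverse c *s (c *s x) \<in> S"
    using assms(1) vec.subspace_scale by blast
  then show "c = 0"
    using assms(2) by (cases "c = 0") auto
qed (use assms vec.subspace_0 in auto)

text \<open>
  A point outside \<open>H\<close> is spanned by a vector \<open>c *s a + h\<close> with \<open>c \<noteq> 0\<close>; normalizing \<open>c\<close> to \<open>1\<close>
  picks one vector from each affine point.
\<close>

lemma bij_betw_affine_pt:
  assumes "proj_hyperplane H" and "a \<notin> H"
  shows "bij_betw (affine_pt a) H (AG_points H)"
proof (rule bij_betwI')
  have H: "vec.subspace H" "vec.dim H + 1 = CARD('b)"
    using assms(1) by (auto simp: proj_hyperplane_def)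
  note notin = translate_notin [OF H(1) assms(2)]
  {
    fix h h' assume h: "h \<in> H" "h' \<in> H"
    show "affine_pt a h = affine_pt a h' \<longleftrightarrow> h = h'"
    proof
      assume "affine_pt a h = affine_pt a h'"
      then have "a + h \<in> vec.span {a + h'}"
        by (auto simp: affine_pt_def intro: vec.span_base)
      then obtain c where c: "a + h = c *s (a + h')"
        by (auto simp: vec.span_singleton)
      (* Comparing the components along a, which lies outside H, forces c = 1. *)
      then have "(1 - c) *s a = c *s h' - h"
        by (simp add: vec.scale_left_diff_distrib vec.scale_right_distrib algebra_simps)
      then have "(1 - c) *s a \<in> H"
        using H(1) h by (simp add: vec.subspace_diff vec.subspace_scale)
      then show "h = h'"
        using c scale_mem_iff [OF H(1) assms(2)] by simp
    qed simp
  next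
    fix h assume h: "h \<in> H"
    have "a + h \<noteq> 0"
      using notin [OF h] vec.subspace_0 [OF H(1)] by auto
    then show "affine_pt a h \<in> AG_points H"
      using notin [OF h] affine_pt_subset_iff [OF H(1), of a h]
      by (simp add: AG_points_def affine_part_def proj_subspace_def) (simp add: affine_pt_def)
  next
    fix P assume "P \<in> AG_points H"
    then have P: "vec.subspace P" "vec.dim P = 1" "\<not> P \<subseteq> H"
      by (auto simp: AG_points_def affine_part_def proj_subspace_def)
    then obtain p where p: "p \<in> P" "p \<notin> H" by blast
    have "vec.span (insert a H) = UNIV"
      using H assms(2) by (intro span_insert_hyperplane) (auto simp: card_cart_basis)
    then obtain c where c: "p - c *s a \<in> H"
      using vec.span_breakdown_eq [of p a H] vec.span_eq_iff [THEN iffD2, OF H(1)] by auto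
    then have "c \<noteq> 0" using p(2) by auto
    define h where "h = inverse c *s (p - c *s a)"
    have h: "h \<in> H"
      unfolding h_def using c H(1) by (rule vec.subspace_scale [rotated])
    have "a + h = inverse c *s p"
      using \<open>c \<noteq> 0\<close> by (simp add: h_def vec.scale_right_diff_distrib)
    then have "affine_pt a h \<subseteq> P"
      using P(1) p(1) by (simp add: affine_pt_subset_iff vec.subspace_scale)
    moreover have "vec.dim P \<le> vec.dim (affine_pt a h)"
      using P(2) notin [OF h] vec.subspace_0 [OF H(1)] by (auto simp: affine_pt_def)
    ultimately have "affine_pt a h = P"
      using P(1) by (intro vec.subspace_dim_equal) (auto simp: affine_pt_def)
    with h show "\<exists>h\<in>H. P = affine_pt a h" by blast
  }
qed

text \<open>
  If \<open>S\<close> contains both vectors, it contains their difference, which lies in \<open>H\<close>. Conversely, the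
  span of \<open>W\<close> and \<open>a + h\<close> is a hyperplane that meets \<open>H\<close> only in \<open>W\<close>, because \<open>a + h\<close> is outside
  \<open>H\<close>; it contains \<open>a + h'\<close> as soon as \<open>h - h' \<in> W\<close>.
\<close>

lemma common_hyperplane_iff:
  fixes H :: "('k::field ^ 'm::finite) set"
  assumes "proj_hyperplane H" and "a \<notin> H" and "W \<in> hyperplanes_of H" and "h \<in> H" "h' \<in> H"
  shows "(\<exists>S. proj_hyperplane S \<and> S \<inter> H = W \<and> a + h \<in> S \<and> a + h' \<in> S) \<longleftrightarrow> h - h' \<in> W"
proof
  assume "\<exists>S. proj_hyperplane S \<and> S \<inter> H = W \<and> a + h \<in> S \<and> a + h' \<in> S"
  then obtain S where S: "vec.subspace S" "S \<inter> H = W" "a + h \<in> S" "a + h' \<in> S"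
    by (auto simp: proj_hyperplane_def)
  have "(a + h) - (a + h') \<in> S"
    using S by (intro vec.subspace_diff)
  moreover have "h - h' \<in> H"
    using assms by (auto simp: proj_hyperplane_def intro: vec.subspace_diff)
  ultimately show "h - h' \<in> W"
    using S(2) by auto
next
  assume diff: "h - h' \<in> W"
  have H: "vec.subspace H" "vec.dim H + 1 = CARD('m)"
    using assms(1) by (auto simp: proj_hyperplane_def)
  have W: "vec.subspace W" "W \<subseteq> H" "vec.dim W + 1 = vec.dim H"
    using assms(3) by (auto simp: hyperplanes_of_def)
  have notin: "a + h \<notin> H"
    using translate_notin [OF H(1) assms(2,4)] .
  define S where "S = vec.span (insert (a + h) W)"
  have hyp: "proj_hyperplane S"
  proof -
    have "a + h \<notin> W"
      using notin W(2) by blast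
    from dim_span_insert_subspace [OF W(1) this] show ?thesis
      using W(3) H(2) by (simp add: S_def proj_hyperplane_def)
  qed
  have "S \<inter> H \<subseteq> W"
  proof
    fix x assume x: "x \<in> S \<inter> H"
    then obtain c where c: "x - c *s (a + h) \<in> W"
      using W(1) by (auto simp: S_def vec.span_breakdown_eq vec.span_eq_iff [THEN iffD2])
    with x W(2) have "x \<in> H" "x - c *s (a + h) \<in> H"
      by auto
    then have "x - (x - c *s (a + h)) \<in> H"
      by (rule vec.subspace_diff [OF H(1)])
    then have "c *s (a + h) \<in> H"
      by (simp only: diff_diff_eq2 add_diff_cancel_left')
    then have "c = 0"
      using scale_mem_iff [OF H(1) notin] by blast
    with c show "x \<in> W" by simp
  qed
  moreover have "W \<subseteq> S"
    by (auto simp: S_def intro: vec.span_base)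
  moreover have "a + h \<in> S"
    by (auto simp: S_def intro: vec.span_base)
  moreover have "(a + h) - (h - h') \<in> S"
    unfolding S_def using diff by (intro vec.span_diff [of "a + h"] vec.span_base) auto
  ultimately show "\<exists>S. proj_hyperplane S \<and> S \<inter> H = W \<and> a + h \<in> S \<and> a + h' \<in> S"
    using hyp W(2) by (intro exI [of _ S]) auto
qed

lemma parallel_factor_edge_iff:
  fixes H :: "('k::field ^ 'm::finite) set"
  assumes "proj_hyperplane H" and "a \<notin> H" and "W \<in> hyperplanes_of H" and "h \<in> H" "h' \<in> H"
  shows "{affine_pt a h, affine_pt a h'} \<in> parallel_factor H W \<longleftrightarrow> h \<noteq> h' \<and> h - h' \<in> W"
proof -
  have pts: "affine_pt a x \<in> affine_part H S \<longleftrightarrow> a + x \<in> S"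
    if "x \<in> H" "proj_hyperplane S" for x S
    using bij_betwE [OF bij_betw_affine_pt [OF assms(1,2)]] that affine_pt_subset_iff [of S a x]
    by (auto simp: AG_points_def affine_part_def proj_hyperplane_def)
  have "{affine_pt a h, affine_pt a h'} \<in> parallel_factor H W \<longleftrightarrow>
      (\<exists>S. proj_hyperplane S \<and> S \<inter> H = W \<and>
        {affine_pt a h, affine_pt a h'} \<in> complete_edges (affine_part H S))"
    by (auto simp: parallel_factor_def parallel_hyperplanes_def)
  also have "\<dots> \<longleftrightarrow> affine_pt a h \<noteq> affine_pt a h' \<and>
      (\<exists>S. proj_hyperplane S \<and> S \<inter> H = W \<and> a + h \<in> S \<and> a + h' \<in> S)"
    using pts assms(4,5) by (auto simp: complete_edges_def card_insert_if)
  also have "\<dots> \<longleftrightarrow> h \<noteq> h' \<and> h - h' \<in> W"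
    using common_hyperplane_iff [OF assms]
      bij_betw_imp_inj_on [OF bij_betw_affine_pt [OF assms(1,2)]] assms(4,5)
    by (simp add: inj_on_eq_iff)
  finally show ?thesis .
qed

lemma complete_edgeE:
  assumes "e \<in> complete_edges V" and "bij_betw f A V"
  obtains x y where "x \<in> A" "y \<in> A" "x \<noteq> y" "e = {f x, f y}"
proof -
  obtain u v where uv: "e = {u, v}" "u \<noteq> v" "u \<in> V" "v \<in> V"
    using assms(1) by (auto simp: complete_edges_def card_2_iff)
  moreover have "V = f ` A"
    using assms(2) by (simp add: bij_betw_def)
  ultimately show ?thesis
    using that by blast
qed

lemma parallel_factor_subset: "parallel_factor H W \<subseteq> complete_edges (AG_points H)"
proof -
  have "affine_part H S \<subseteq> AG_points H" for S
    by (auto simp: AG_points_def affine_part_def)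
  then show ?thesis
    by (fastforce simp: parallel_factor_def parallel_hyperplanes_def complete_edges_def)
qed

text \<open>
  In the coordinate of \<open>affine_pt\<close>, the neighbours of \<open>h\<close> are the \<open>h - w\<close> with \<open>w\<close> a nonzero
  element of \<open>W\<close>.
\<close>

lemma graph_factor_parallel_factor:
  fixes H :: "('k::{field,finite} ^ 'm::finite) set"
  assumes H: "proj_hyperplane H" and W: "W \<in> hyperplanes_of H"
  shows "graph_factor (AG_points H) (CARD('k) ^ vec.dim W - 1) (parallel_factor H W)"
proof -
  have subH: "vec.subspace H" and subW: "vec.subspace W" "W \<subseteq> H"
    using H W by (auto simp: proj_hyperplane_def hyperplanes_of_def)
  have "H \<noteq> UNIV"
    using H by (auto simp: proj_hyperplane_def card_cart_basis)
  then obtain a where a: "a \<notin> H" by blast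
  note bij = bij_betw_affine_pt [OF H a] and edge = parallel_factor_edge_iff [OF H a W]
  have "card {e \<in> parallel_factor H W. v \<in> e} = CARD('k) ^ vec.dim W - 1"
    if "v \<in> AG_points H" for v
  proof -
    have "v \<in> affine_pt a ` H"
      using that bij_betw_imp_surj_on [OF bij] by simp
    then obtain h where h: "h \<in> H" "v = affine_pt a h"
      by blast
    let ?f = "\<lambda>w. {affine_pt a h, affine_pt a (h - w)}"
    have cl: "h - w \<in> H" if "w \<in> W" for w
      using that h(1) subH subW(2) by (auto intro: vec.subspace_diff)
    have "{e \<in> parallel_factor H W. v \<in> e} = ?f ` (W - {0})"
    proof (intro equalityI subsetI)
      fix e assume e: "e \<in> {e \<in> parallel_factor H W. v \<in> e}"
      then have "e \<in> complete_edges (AG_points H)"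
        using parallel_factor_subset by blast
      then obtain x y where xy: "x \<in> H" "y \<in> H" "x \<noteq> y" "e = {affine_pt a x, affine_pt a y}"
        using bij by (rule complete_edgeE)
      have "h = x \<or> h = y"
        using e h xy bij by (auto simp: bij_betw_def inj_on_eq_iff)
      then have "\<exists>z\<in>H. e = {affine_pt a h, affine_pt a z}"
      proof
        assume "h = x"
        with xy show ?thesis by blast
      next
        assume "h = y"
        with xy show ?thesis by (intro bexI [of _ x]) auto
      qed
      then obtain z where z: "z \<in> H" "e = {affine_pt a h, affine_pt a z}"
        by blast
      then have "h - z \<in> W - {0}"
        using edge [OF h(1) z(1)] e by auto
      with z(2) show "e \<in> ?f ` (W - {0})"
        by (intro image_eqI [of _ _ "h - z"]) auto
    next
      fix e assume "e \<in> ?f ` (W - {0})"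
      then show "e \<in> {e \<in> parallel_factor H W. v \<in> e}"
        using edge [OF h(1) cl] h(2) by auto
    qed
    moreover have "inj_on ?f (W - {0})"
    proof (rule inj_onI)
      fix x y assume xy: "x \<in> W - {0}" "y \<in> W - {0}" "?f x = ?f y"
      then have "affine_pt a (h - x) = affine_pt a (h - y)"
        by (auto simp: doubleton_eq_iff)
      then have "h - x = h - y"
        using inj_onD [OF bij_betw_imp_inj_on [OF bij]] cl xy(1,2) by blast
      then show "x = y" by simp
    qed
    ultimately have "card {e \<in> parallel_factor H W. v \<in> e} = card (W - {0})"
      by (simp add: card_image)
    then show ?thesis
      using card_subspace [OF subW(1)] vec.subspace_0 [OF subW(1)] by simp
  qed
  then show ?thesis
    using parallel_factor_subset by (auto simp: graph_factor_def)
qed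

theorem theorem3p3:
  fixes H :: "('k::{field,finite} ^ 'm::finite) set"
    and n q :: nat
  assumes "n \<ge> 2"
    and "CARD('k) = q"
    and "CARD('m) = n + 1"
    and "proj_hyperplane H"
  shows "card (AG_points H) = q ^ n \<and>
    graph_factorization (AG_points H) (q ^ (n - 1) - 1) ((q ^ (n - 1) - 1) div (q - 1))
      (AG_factorization n H) \<and>
    \<not> decomposable (AG_points H) (q ^ (n - 1) - 1) ((q ^ (n - 1) - 1) div (q - 1))
      (AG_factorization n H)"
proof -
  define l where "l = (q ^ (n - 1) - 1) div (q - 1)"
  have q: "2 \<le> q"
    using card_field_ge_2 [where 'k = 'k] assms(2) by simp
  have H: "vec.subspace H" "vec.dim H = n"
    using assms(3,4) by (auto simp: proj_hyperplane_def)
  have "\<not> H \<subseteq> {0}"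
    using H(2) assms(1) vec.dim_eq_0 [of H] by linarith
  then obtain d where "d \<in> H" "d \<noteq> 0" by blast
  (* The quotient is the number of hyperplanes of H through d. *)
  then have "(q - 1) dvd (q ^ (n - 1) - 1)"
    using card_hyperplanes_through [OF H(1), of d] H(2) assms(2)
    by (intro dvdI [where k = "card {W \<in> hyperplanes_of H. d \<in> W}"]) (simp add: mult.commute)
  then have l: "l * (q - 1) = q ^ (n - 1) - 1"
    by (simp add: l_def)
  have "H \<noteq> UNIV"
    using assms(3) H by (auto simp: card_cart_basis)
  then obtain a where a: "a \<notin> H" by blast
  note bij = bij_betw_affine_pt [OF assms(4) a]
  have card_pts: "card (AG_points H) = q ^ n"
    using bij_betw_same_card [OF bij] card_subspace [OF H(1)] H(2) assms(2) by simp
  have classes: "{W. proj_subspace (n - 2) W \<and> W \<subseteq> H} = hyperplanes_of H"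
    using assms(1) H(2) by (auto simp: proj_subspace_def hyperplanes_of_def)
  have factors: "graph_factor (AG_points H) (q ^ (n - 1) - 1) E"
    if "E \<in># AG_factorization n H" for E
  proof -
    have "E \<in> parallel_factor H ` hyperplanes_of H"
      using that by (simp add: AG_factorization_def classes)
    then obtain W where W: "W \<in> hyperplanes_of H" "E = parallel_factor H W"
      by blast
    then have "vec.dim W = n - 1"
      using H(2) by (auto simp: hyperplanes_of_def)
    then show ?thesis
      using graph_factor_parallel_factor [OF assms(4) W(1)] W(2) assms(2) by simp
  qed
  have multiplicity: "size (filter_mset (\<lambda>E. e \<in> E) (AG_factorization n H)) = l"
    if e: "e \<in> complete_edges (AG_points H)" for e
  proof -
    obtain x y where xy: "x \<in> H" "y \<in> H" "x \<noteq> y" "e = {affine_pt a x, affine_pt a y}"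
      by (rule complete_edgeE [OF e bij])
    have "size (filter_mset (\<lambda>E. e \<in> E) (AG_factorization n H))
        = card {W \<in> hyperplanes_of H. e \<in> parallel_factor H W}"
      by (simp add: AG_factorization_def classes filter_mset_image_mset)
    also have "{W \<in> hyperplanes_of H. e \<in> parallel_factor H W}
        = {W \<in> hyperplanes_of H. x - y \<in> W}"
      using parallel_factor_edge_iff [OF assms(4) a _ xy(1,2)] xy(3,4) by auto
    finally have "size (filter_mset (\<lambda>E. e \<in> E) (AG_factorization n H)) * (q - 1)
        = l * (q - 1)"
      using card_hyperplanes_through [OF H(1), of "x - y"] xy H assms(2) l
      by (simp add: vec.subspace_diff)
    then show ?thesis
      using q by simp
  qed
  have "graph_factorization (AG_points H) (q ^ (n - 1) - 1) l (AG_factorization n H)"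
    using factors multiplicity by (auto simp: graph_factorization_def)
  moreover have "\<not> decomposable (AG_points H) (l * (q - 1)) l (AG_factorization n H)"
  proof (rule indecomposable_if_coprime)
    (* q ^ n - 1 = q * (l * (q - 1) + 1) - 1 = (q * l + 1) * (q - 1) *)
    have "q ^ n = q * q ^ (n - 1)"
      using assms(1) by (cases n) auto
    moreover have "q ^ (n - 1) = l * (q - 1) + 1"
      using l q by simp
    moreover obtain p where "q = Suc p"
      using q by (cases q) auto
    ultimately show "card (AG_points H) - 1 = (q * l + 1) * (q - 1)"
      using card_pts by (simp add: algebra_simps)
    show "coprime l (q * l + 1)"
      using gcd_add_mult [of l q 1] by (simp add: coprime_iff_gcd_eq_1)
    show "AG_points H \<noteq> {}"
      using card_pts q by auto
  qed (use q in auto)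
  ultimately show ?thesis
    using card_pts l l_def by simp
qed

end
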